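(* Consider the two-stage market described in the context, in which real-time bids are day-ahead decision-aware: $$g_j^r=\alpha_j^r\lambda^r-g_j^d\quad(j\in\mathcal G),\qquad u_s^r=\beta_s^r\lambda^r-u_s^d\quad(s\in\mathcal S).$$ Then the competitive equilibrium of this mixed market mechanism in the real-time market exists uniquely, and it is given by $$\lambda^r=\phi d,\qquad \alpha_j^r=c_j^{-1}\ (j\in\mathcal G),\qquad \beta_s^r=b_s^{-1}\frac{\|\lambda^r\|_2^2}{\|N(\lambda^r)\lambda^r\|_2^2}\ (s\in\mathcal S),$$ $$\phi^{-1}=\sum_{s\in\mathcal S}b_s^{-1}\frac{\|d\|_2^2}{\|N(d)d\|_2^2}+\sum_{j\in\mathcal G}c_j^{-1},$$ where $d=d^d+d^r$ is the net demand.
   Context: **Participants.** $\mathcal G$ is a finite set of generators, $\mathcal S$ a finite set of storage units, and the time horizon is $\mathcal T=\{1,\dots,T\}$. The day-ahead demand forecast is $d^d\in\mathbb R^T$, the real-time forecast error is $d^r\in\mathbb R^T$, and $d=d^d+d^r$. Generator $j$ dispatches $g_j^d,g_j^r\in\mathbb R^T$ in the day-ahead and real-time stages and has cost $C_j(g)=\frac{c_j}{2}\|g\|_2^2$ with $c_j>0$. Storage $s$ dispatches $u_s^d,u_s^r\in\mathbb R^T$ and has cost $C_s(u)=\frac{b_s}{2}\|N(u)u\|_2^2$ with $b_s>0$. **Rainflow map.** The vector $\nu=N(u)u\in\mathbb R^T$ is the vector of half-cycle depths produced by the Rainflow cycle counting algorithm from the dispatch profile $u\in\mathbb R^T$, where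 $N(u)$ is a matrix depending on $u$. Concretely, let $y_0=0$ and $y_t=\sum_{\tau\le t}u_\tau$, and list the turning points of $y_0,\dots,y_T$, endpoints included. While there are four consecutive points in the list whose middle range (absolute difference of the two middle points) is at most each of the two neighbouring ranges, record two half-cycles (one full cycle) whose depth is the middle range and delete the two middle points. When no such four points remain, record one half-cycle for each pair of consecutive remaining points, with depth equal to their absolute difference. The vector of depths is padded by zeros to length $T$. A half-cycle between times $p<q$ has depth $|y_q-y_p|$, and it corresponds to the row of $N(u)$ with entries $\mathrm{sgn}(y_q-y_p)$ for $p<t\le q$ and $0$ otherwise; padding rows are zero. The map $N$ is the same for all storage units. **Day-ahead market.** The day-ahead decisions $g_j^d,u_s^d$ (with cycle depths $\nu_s^d=N(u_s^d)u_s^d$) and day-ahead prices $\lambda^d,\theta_s^d\in\mathbb R^T$ are given and fixed. The day-ahead power balance $\sum_{j}g_j^d+\sum_{s}u_s^d=d^d$ holds. **Real-time market.** The only clearing constraint considered is the power balance. Generators bid $\alpha_j^r\in\mathbb R$ and storage units bid $\beta_s^r\in\mathbb R$, with the bid functions in the claim, where $\lambda^r\in\mathbb R^T$ is the real-time price vector. **Competitive equilibrium of the real-time market.** A tuple $(\lambda^r,(\alpha_j^r)_j,(\beta_s^r)_s)$ is a competitive equilibrium if all of the following hold, with the day-ahead quantities and the price $\lambda^r$ taken as given (price-taking participants): 1. each $\alpha_j^r\in\mathbb R$ maximizes $\langle\lambda^d,g_j^d\rangle+\langle\lambda^r,g_j^r\rangle-C_j(g_j^d+g_j^r)$ with $g_j^r=\alpha_j^r\lambda^r-g_j^d$;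 2. each $\beta_s^r\in\mathbb R$ maximizes $\langle\theta_s^d,\nu_s^d\rangle+\langle\lambda^r,u_s^r\rangle-C_s(u_s^d+u_s^r)$ with $u_s^r=\beta_s^r\lambda^r-u_s^d$; 3. demand is met: $d^r=\sum_{j}(\alpha_j^r\lambda^r-g_j^d)+\sum_{s}(\beta_s^r\lambda^r-u_s^d)$. Denominators appearing in the formulas are understood to be nonzero. *)

theory Defs
  imports "HOL-Analysis.Analysis"
begin

section \<open>Rainflow cycle counting\<close>

text \<open>
  The time horizon \<open>{1,\<dots>,T}\<close> is a finite linearly ordered index type \<open>'t\<close> with
  \<open>T = CARD('t)\<close>; \<open>time_index\<close> is its order isomorphism onto \<open>{1..T}\<close>.
\<close>

definition time_index :: "'t::{finite,linorder} \<Rightarrow> nat" where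
  "time_index t = card {..t}"

definition profile :: "real ^ 't::{finite,linorder} \<Rightarrow> nat \<Rightarrow> real" where
  "profile u k = (\<Sum>t | time_index t \<le> k. u $ t)"

text \<open>
  On a plateau the first index represents the turning point. The other indices of the plateau
  carry the same value of \<open>y\<close>, so this choice does not affect any depth.
\<close>

definition turning_points :: "nat \<Rightarrow> (nat \<Rightarrow> real) \<Rightarrow> nat list" where
  "turning_points T y = sorted_list_of_set ({0, T} \<union>
     {k. 0 < k \<and> k < T \<and>
        (\<exists>m. k < m \<and> m \<le> T \<and> (\<forall>i. k \<le> i \<and> i < m \<longrightarrow> y i = y k) \<and>
             (y k - y (k - 1)) * (y m - y k) < 0)})"

definition closed_cycle :: "(nat \<Rightarrow> real) \<Rightarrow> nat \<Rightarrow> nat \<Rightarrow> nat \<Rightarrow> nat \<Rightarrow> bool" where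
  "closed_cycle y p q r s \<longleftrightarrow> \<bar>y r - y q\<bar> \<le> \<bar>y q - y p\<bar> \<and> \<bar>y r - y q\<bar> \<le> \<bar>y s - y r\<bar>"

text \<open>
  \<open>rainflow y ps hs\<close>: counting from the list \<open>ps\<close> of time points can record the half-cycles
  \<open>hs\<close>, each given by its two time points. If several cycles can be extracted,
  any of them may be taken first.
\<close>

inductive rainflow :: "(nat \<Rightarrow> real) \<Rightarrow> nat list \<Rightarrow> (nat \<times> nat) list \<Rightarrow> bool"
  for y :: "nat \<Rightarrow> real" where
  full_cycle: "closed_cycle y p q r s \<Longrightarrow> rainflow y (xs @ [p, s] @ zs) hs \<Longrightarrow>
     rainflow y (xs @ [p, q, r, s] @ zs) ((q, r) # (q, r) # hs)"
| residue: "\<nexists>xs p q r s zs. ps = xs @ [p, q, r, s] @ zs \<and> closed_cycle y p q r s \<Longrightarrow>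
     rainflow y ps (zip ps (tl ps))"

text \<open>
  A run starting from \<open>n + 1\<close> points records exactly \<open>n\<close> half-cycles, so the at most \<open>T + 1\<close>
  turning points of a profile give at most \<open>T\<close> half-cycles and all of them have a row.
\<close>

definition half_cycle_matrix ::
    "(nat \<Rightarrow> real) \<Rightarrow> (nat \<times> nat) list \<Rightarrow>
     real ^ 't::{finite,linorder} ^ 't::{finite,linorder}" where
  "half_cycle_matrix y hs = (\<chi> i t.
     if time_index i \<le> length hs
     then (case hs ! (time_index i - 1) of (p, q) \<Rightarrow>
             if p < time_index t \<and> time_index t \<le> q then sgn (y q - y p) else 0)
     else 0)"

definition rainflow_map ::
    "(real ^ 't::{finite,linorder} \<Rightarrow> real ^ 't::{finite,linorder} ^ 't::{finite,linorder}) \<Rightarrow> bool" where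
  "rainflow_map N \<longleftrightarrow> (\<forall>u. \<exists>hs.
     rainflow (profile u) (turning_points CARD('t) (profile u)) hs \<and>
     N u = half_cycle_matrix (profile u) hs)"

lemma rainflow_exists: "\<exists>hs. rainflow y ps hs"
proof (induction "length ps" arbitrary: ps rule: less_induct)
  case less
  show ?case
  proof (cases "\<exists>xs p q r s zs. ps = xs @ [p, q, r, s] @ zs \<and> closed_cycle y p q r s")
    case True
    then obtain xs p q r s zs
      where ps: "ps = xs @ [p, q, r, s] @ zs" and c: "closed_cycle y p q r s"
      by blast
    have "length (xs @ [p, s] @ zs) < length ps"
      by (simp add: ps)
    from less[OF this] obtain hs where "rainflow y (xs @ [p, s] @ zs) hs" ..
    from rainflow.full_cycle[OF c this] show ?thesis
      unfolding ps ..
  next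
    case False
    then show ?thesis
      using rainflow.residue by blast
  qed
qed

lemma rainflow_map_exists: "\<exists>N. rainflow_map N"
  unfolding rainflow_map_def by (rule choice) (use rainflow_exists in blast)

lemma rainflow_length: "rainflow y ps hs \<Longrightarrow> length hs = length ps - 1"
  by (induction rule: rainflow.induct) auto


section \<open>The real-time market\<close>

definition generator_cost :: "real \<Rightarrow> real ^ 't \<Rightarrow> real" where
  "generator_cost c g = c / 2 * (norm g)\<^sup>2"

definition storage_cost ::
    "(real ^ 't \<Rightarrow> real ^ 't ^ 't) \<Rightarrow> real \<Rightarrow> real ^ 't \<Rightarrow> real" where
  "storage_cost N b u = b / 2 * (norm (N u *v u))\<^sup>2"

definition real_time_dispatch :: "real \<Rightarrow> real ^ 't \<Rightarrow> real ^ 't \<Rightarrow> real ^ 't" where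
  "real_time_dispatch a lr xd = a *\<^sub>R lr - xd"

definition generator_profit ::
    "real ^ 't \<Rightarrow> real ^ 't \<Rightarrow> real \<Rightarrow> real ^ 't \<Rightarrow> real \<Rightarrow> real" where
  "generator_profit ld lr c gd a =
     ld \<bullet> gd + lr \<bullet> real_time_dispatch a lr gd
     - generator_cost c (gd + real_time_dispatch a lr gd)"

definition storage_profit ::
    "(real ^ 't \<Rightarrow> real ^ 't ^ 't) \<Rightarrow> real ^ 't \<Rightarrow> real ^ 't \<Rightarrow> real \<Rightarrow> real ^ 't \<Rightarrow> real \<Rightarrow> real" where
  "storage_profit N thd lr b ud a =
     thd \<bullet> (N ud *v ud) + lr \<bullet> real_time_dispatch a lr ud
     - storage_cost N b (ud + real_time_dispatch a lr ud)"

definition competitive_equilibrium ::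
    "(real ^ 't \<Rightarrow> real ^ 't ^ 't) \<Rightarrow> 'g set \<Rightarrow> 's set \<Rightarrow> ('g \<Rightarrow> real) \<Rightarrow> ('s \<Rightarrow> real) \<Rightarrow>
     real ^ 't \<Rightarrow> ('s \<Rightarrow> real ^ 't) \<Rightarrow> ('g \<Rightarrow> real ^ 't) \<Rightarrow> ('s \<Rightarrow> real ^ 't) \<Rightarrow> real ^ 't \<Rightarrow>
     real ^ 't \<Rightarrow> ('g \<Rightarrow> real) \<Rightarrow> ('s \<Rightarrow> real) \<Rightarrow> bool" where
  "competitive_equilibrium N G S c b ld thd gd ud dr lr \<alpha> \<beta> \<longleftrightarrow>
     (\<forall>j\<in>G. is_arg_max (generator_profit ld lr (c j) (gd j)) (\<lambda>_. True) (\<alpha> j)) \<and>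
     (\<forall>s\<in>S. is_arg_max (storage_profit N (thd s) lr (b s) (ud s)) (\<lambda>_. True) (\<beta> s)) \<and>
     dr = (\<Sum>j\<in>G. real_time_dispatch (\<alpha> j) lr (gd j))
        + (\<Sum>s\<in>S. real_time_dispatch (\<beta> s) lr (ud s))"

end

theory Submission
  imports Defs
begin

text \<open>
  The heart of the matter is that \<open>u \<mapsto> \<parallel>N(u)u\<parallel>\<close> is absolutely homogeneous. Scaling a profile
  changes neither its turning points nor the extractable cycles, but \<open>N\<close> may resolve ties
  differently at \<open>u\<close> and \<open>a u\<close>, so one also needs that all runs of the rainflow
  algorithm record the same sum of squared depths. This is a diamond argument: on an alternating
  list of values two different extractions either commute or, when they overlap,
  leave the same values behind.

  Given homogeneity, the profits are concave quadratics in the bids. Power balance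
  reads \<open>K \<lambda>\<^sup>r = d\<close> with \<open>K = \<Sum>\<alpha> + \<Sum>\<beta>\<close>, and \<open>d \<noteq> 0\<close> makes \<open>\<lambda>\<^sup>r\<close> a nonzero multiple of \<open>d\<close>; the optimal
  bids depend on \<open>\<lambda>\<^sup>r\<close> only through its direction, hence \<open>K = \<phi>\<^sup>-\<^sup>1\<close>.
\<close>

section \<open>Confluence of cycle extraction\<close>

text \<open>Lists of length at most two count as alternating even if their entries are equal. This
  covers a constant profile, whose only turning points are the two endpoints.\<close>

fun alternating :: "real list \<Rightarrow> bool" where
  "alternating (a # b # c # xs) \<longleftrightarrow> (b - a) * (c - b) < 0 \<and> alternating (b # c # xs)"
| "alternating _ \<longleftrightarrow> True"

lemma alternatingI:
  assumes "\<And>xs a b c zs. l = xs @ [a, b, c] @ zs \<Longrightarrow> (b - a) * (c - b) < 0"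
  shows "alternating l"
  using assms
proof (induction l rule: alternating.induct)
  case (1 a b c xs)
  have "alternating (b # c # xs)"
  proof (rule "1.IH")
    fix ys p q r zs
    assume "b # c # xs = ys @ [p, q, r] @ zs"
    then show "(q - p) * (r - q) < 0"
      by (intro "1.prems"[of "a # ys" p q r zs]) simp
  qed
  then show ?case
    using "1.prems"[of "[]" a b c xs] by simp
qed simp_all

lemma alternating_appendD: "alternating (xs @ ys) \<Longrightarrow> alternating ys"
proof (induction xs)
  case (Cons x xs)
  have "alternating (x # zs) \<Longrightarrow> alternating zs" for zs
    by (cases "x # zs" rule: alternating.cases) auto
  then show ?case
    using Cons by simp
qed simp

text \<open>Lists of values replace lists of time points, because two extractions may keep different
  times that carry equal values. The factor 2 in \<open>w\<close> accounts for the two half-cycles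
  of a full cycle.\<close>

definition cycle_step :: "real list \<Rightarrow> real \<Rightarrow> real list \<Rightarrow> bool" where
  "cycle_step l w l' \<longleftrightarrow> (\<exists>xs a b c d zs. l = xs @ [a, b, c, d] @ zs \<and>
     \<bar>c - b\<bar> \<le> \<bar>b - a\<bar> \<and> \<bar>c - b\<bar> \<le> \<bar>d - c\<bar> \<and> w = 2 * (c - b)\<^sup>2 \<and> l' = xs @ [a, d] @ zs)"

lemma cycle_stepI:
  "\<lbrakk>l = xs @ [a, b, c, d] @ zs; \<bar>c - b\<bar> \<le> \<bar>b - a\<bar>; \<bar>c - b\<bar> \<le> \<bar>d - c\<bar>; w = 2 * (c - b)\<^sup>2;
    l' = xs @ [a, d] @ zs\<rbrakk> \<Longrightarrow> cycle_step l w l'"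
  unfolding cycle_step_def by blast

lemma cycle_step_length: "cycle_step l w l' \<Longrightarrow> length l' < length l"
  unfolding cycle_step_def by auto

text \<open>The outer moves go against the middle move and are at least as long, so the interval
  between \<open>b\<close> and \<open>c\<close> is nested in the one between \<open>a\<close> and
  \<open>d\<close>. This form frees later arguments from absolute values.\<close>

lemma zigzag_middle:
  fixes a b c d :: real
  assumes "(b - a) * (c - b) < 0" "(c - b) * (d - c) < 0"
    and "\<bar>c - b\<bar> \<le> \<bar>b - a\<bar>" "\<bar>c - b\<bar> \<le> \<bar>d - c\<bar>"
  shows "a < b \<and> c < b \<and> a \<le> c \<and> b \<le> d \<and> a < d \<or> b < a \<and> b < c \<and> c \<le> a \<and> d \<le> b \<and> d < a"
  using assms by (auto simp: mult_less_0_iff)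

text \<open>The prefix sees only the direction in which the list leaves \<open>a\<close>, and the
  last hypothesis says that both tails leave it in the same direction.\<close>

lemma alternating_replace_tail:
  assumes "alternating (xs @ a # b # ys)" "alternating (a # d # zs)" "(b - a) * (d - a) > 0"
  shows "alternating (xs @ a # d # zs)"
  using assms(1)
proof (induction xs)
  case Nil
  then show ?case
    using assms by simp
next
  case (Cons x xs)
  show ?case
  proof (cases xs)
    case Nil
    then show ?thesis
      using Cons.prems assms by (auto simp: mult_less_0_iff zero_less_mult_iff)
  next
    case (Cons y xs')
    then show ?thesis
      using Cons.IH Cons.prems by (cases xs') auto
  qed
qed

text \<open>By nesting, the new move from \<open>a\<close> to \<open>d\<close> has the direction of
  both deleted outer moves, so the sign changes at \<open>a\<close> and at \<open>d\<close>
  survive.\<close>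

lemma alternating_cycle_step:
  assumes "alternating l" "cycle_step l w l'"
  shows "alternating l'"
proof -
  obtain xs a b c d zs where l: "l = xs @ [a, b, c, d] @ zs"
    and le: "\<bar>c - b\<bar> \<le> \<bar>b - a\<bar>" "\<bar>c - b\<bar> \<le> \<bar>d - c\<bar>" and l': "l' = xs @ [a, d] @ zs"
    using assms(2) unfolding cycle_step_def by blast
  have alt: "alternating (a # b # c # d # zs)"
    using assms(1) l alternating_appendD by fastforce
  then have zz: "a < b \<and> c < b \<and> a \<le> c \<and> b \<le> d \<and> a < d \<or> b < a \<and> b < c \<and> c \<le> a \<and> d \<le> b \<and> d < a"
    using zigzag_middle le by auto
  have "alternating (a # d # zs)"
    using alt zz by (cases zs) (auto simp: mult_less_0_iff)
  then show ?thesis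
    using alternating_replace_tail[of xs a b "c # d # zs" d zs] assms(1) l l' zz
    by (auto simp: zero_less_mult_iff)
qed

section \<open>Local confluence of extraction\<close>

text \<open>The weights are exchanged: \<open>l1\<close> was reached at weight \<open>v\<close> and
  still owes \<open>w\<close>, and conversely for \<open>l2\<close>, so both routes to
  \<open>l3\<close> total \<open>v + w\<close>.\<close>

definition joinable :: "real \<Rightarrow> real list \<Rightarrow> real \<Rightarrow> real list \<Rightarrow> bool" where
  "joinable v l1 w l2 \<longleftrightarrow>
     v = w \<and> l1 = l2 \<or> (\<exists>l3. cycle_step l1 w l3 \<and> cycle_step l2 v l3)"

lemma joinable_sym: "joinable v l1 w l2 \<Longrightarrow> joinable w l2 v l1"
  unfolding joinable_def by blast

text \<open>The length of \<open>k\<close> is the offset of the second quadruple from the first.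
  Offset 0 is the same extraction, offset 1 makes the two middle pairs share a point, offset 2 makes
  them adjacent, and from offset 3 on neither extraction touches the quadruple of the other.\<close>

lemma cycle_step_joinable_aux:
  assumes alt: "alternating l"
    and l: "l = xs @ [a, b, c, d] @ zs" and le: "\<bar>c - b\<bar> \<le> \<bar>b - a\<bar>" "\<bar>c - b\<bar> \<le> \<bar>d - c\<bar>"
    and l': "l = (xs @ k) @ [a', b', c', d'] @ zs'"
    and le': "\<bar>c' - b'\<bar> \<le> \<bar>b' - a'\<bar>" "\<bar>c' - b'\<bar> \<le> \<bar>d' - c'\<bar>"
  shows "joinable (2 * (c - b)\<^sup>2) (xs @ [a, d] @ zs) (2 * (c' - b')\<^sup>2) ((xs @ k) @ [a', d'] @ zs')"
proof -
  have eq: "[a, b, c, d] @ zs = k @ [a', b', c', d'] @ zs'"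
    using l l' by simp
  have "alternating ([a, b, c, d] @ zs)"
    using alt l alternating_appendD by blast
  then have zz: "a < b \<and> c < b \<and> a \<le> c \<and> b \<le> d \<and> a < d \<or> b < a \<and> b < c \<and> c \<le> a \<and> d \<le> b \<and> d < a"
    using zigzag_middle le by auto
  consider "k = []" | "k = [a]" | "k = [a, b]" | w where "k = a # b # c # w"
    using eq by (cases k; cases "tl k"; cases "tl (tl k)") auto
  then show ?thesis
  proof cases
    case 1
    then show ?thesis
      using eq unfolding joinable_def by simp
  next
    case 2
    \<comment> \<open>The two middle ranges coincide, so alternation forces the values \<open>b\<close> and \<open>d\<close> to be equal.\<close>
    then have e: "a' = b" "b' = c" "c' = d" "zs = d' # zs'"
      using eq by auto
    have "b = d"
      using zz le le' e by auto
    then show ?thesis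
      using 2 e unfolding joinable_def by (auto simp: power2_commute)
  next
    case 3
    then have e: "a' = c" "b' = d" "zs = c' # d' # zs'"
      using eq by auto
    have "alternating ((xs @ [a, b]) @ [c, d, c', d'] @ zs')"
      using alt l e by simp
    then have "alternating ([c, d, c', d'] @ zs')"
      using alternating_appendD by blast
    then have zz': "c < d \<and> c' < d \<and> c \<le> c' \<and> d \<le> d' \<and> c < d' \<or> d < c \<and> d < c' \<and> c' \<le> c \<and> d' \<le> d \<and> d' < c"
      using zigzag_middle le' e by auto
    \<comment> \<open>Each extraction replaces an outer point of the other quadruple by one at least
      as far out (\<open>c\<close> by \<open>a\<close>, or \<open>d\<close> by \<open>d'\<close>),
      so the other cycle stays closed.\<close>
    have "cycle_step (xs @ [a, d] @ zs) (2 * (c' - b')\<^sup>2) (xs @ [a, d'] @ zs')"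
      using e zz zz' by (intro cycle_stepI[where xs = xs and a = a and b = d and c = c' and d = d']) auto
    moreover have "cycle_step ((xs @ k) @ [a', d'] @ zs') (2 * (c - b)\<^sup>2) (xs @ [a, d'] @ zs')"
      using 3 e zz zz' by (intro cycle_stepI[where xs = xs and a = a and b = b and c = c and d = d']) auto
    ultimately show ?thesis
      unfolding joinable_def by blast
  next
    case 4
    then have e: "d # zs = w @ [a', b', c', d'] @ zs'"
      using eq by simp
    \<comment> \<open>\<open>v\<close> is what follows \<open>d\<close> after the second extraction.
      The point \<open>d\<close> itself survives, as the head of \<open>w\<close> or, if
      \<open>w\<close> is empty, as \<open>a'\<close>.\<close>
    define v where "v = tl (w @ [a', d'] @ zs')"
    have v: "w @ [a', d'] @ zs' = d # v"
      using e unfolding v_def by (cases w) auto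
    have "cycle_step (xs @ [a, d] @ zs) (2 * (c' - b')\<^sup>2) (xs @ a # w @ [a', d'] @ zs')"
      using e le' by (intro cycle_stepI[where xs = "xs @ a # w"]) auto
    moreover have "cycle_step ((xs @ k) @ [a', d'] @ zs') (2 * (c - b)\<^sup>2) (xs @ a # w @ [a', d'] @ zs')"
      using 4 v le by (intro cycle_stepI[where xs = xs and zs = v]) auto
    ultimately show ?thesis
      unfolding joinable_def by blast
  qed
qed

lemma cycle_step_joinable:
  assumes "alternating l" "cycle_step l v l1" "cycle_step l w l2"
  shows "joinable v l1 w l2"
proof -
  obtain xs a b c d zs where 1: "l = xs @ [a, b, c, d] @ zs" "\<bar>c - b\<bar> \<le> \<bar>b - a\<bar>" "\<bar>c - b\<bar> \<le> \<bar>d - c\<bar>"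
    "v = 2 * (c - b)\<^sup>2" "l1 = xs @ [a, d] @ zs"
    using assms(2) unfolding cycle_step_def by blast
  obtain xs' a' b' c' d' zs' where 2: "l = xs' @ [a', b', c', d'] @ zs'"
    "\<bar>c' - b'\<bar> \<le> \<bar>b' - a'\<bar>" "\<bar>c' - b'\<bar> \<le> \<bar>d' - c'\<bar>" "w = 2 * (c' - b')\<^sup>2" "l2 = xs' @ [a', d'] @ zs'"
    using assms(3) unfolding cycle_step_def by blast
  have "xs @ [a, b, c, d] @ zs = xs' @ [a', b', c', d'] @ zs'"
    using 1 2 by simp
  then consider k where "xs' = xs @ k" | k where "xs = xs' @ k"
    unfolding append_eq_append_conv2 by blast
  then show ?thesis
  proof cases
    case 1
    with \<open>l = xs @ _\<close> 2 show ?thesis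
      using cycle_step_joinable_aux[OF assms(1), of xs a b c d zs k a' b' c' d' zs']
        \<open>\<bar>c - b\<bar> \<le> \<bar>b - a\<bar>\<close> \<open>\<bar>c - b\<bar> \<le> \<bar>d - c\<bar>\<close> \<open>v = _\<close> \<open>l1 = _\<close> by simp
  next
    case 2
    with \<open>l = xs' @ _\<close> 1 have "joinable w l2 v l1"
      using cycle_step_joinable_aux[OF assms(1), of xs' a' b' c' d' zs' k a b c d zs]
        \<open>\<bar>c' - b'\<bar> \<le> \<bar>b' - a'\<bar>\<close> \<open>\<bar>c' - b'\<bar> \<le> \<bar>d' - c'\<bar>\<close> \<open>w = _\<close> \<open>l2 = _\<close> by simp
    then show ?thesis
      by (rule joinable_sym)
  qed
qed

section \<open>Complete runs and their totals\<close>

inductive cycle_run :: "real list \<Rightarrow> real \<Rightarrow> bool" where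
  step: "cycle_step l w l' \<Longrightarrow> cycle_run l' x \<Longrightarrow> cycle_run l (w + x)"
| stop: "\<nexists>w l'. cycle_step l w l' \<Longrightarrow> cycle_run l (\<Sum>(p, q)\<leftarrow>zip l (tl l). (q - p)\<^sup>2)"

lemma cycle_run_step_cases:
  assumes "cycle_run l x" "cycle_step l v l''"
  obtains w l' y where "cycle_step l w l'" "cycle_run l' y" "x = w + y"
  using assms(1) by cases (use assms(2) that in blast)+

lemma cycle_run_stop_eq:
  assumes "cycle_run l x" "\<nexists>w l'. cycle_step l w l'"
  shows "x = (\<Sum>(p, q)\<leftarrow>zip l (tl l). (q - p)\<^sup>2)"
  using assms(1) by cases (use assms(2) in blast)+

lemma cycle_run_exists: "\<exists>x. cycle_run l x"
proof (induction "length l" arbitrary: l rule: less_induct)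
  case less
  show ?case
  proof (cases "\<exists>w l'. cycle_step l w l'")
    case True
    then obtain w l' where st: "cycle_step l w l'"
      by blast
    then obtain x where "cycle_run l' x"
      using less cycle_step_length by blast
    then show ?thesis
      using cycle_run.step[OF st] by blast
  qed (use cycle_run.stop in blast)
qed

text \<open>Diamond argument by induction on the length: any run from the common reduct
  \<open>l3\<close>, with total \<open>z\<close>, extends to runs from \<open>l1\<close> and
  \<open>l2\<close>. The induction hypothesis then forces \<open>x' = w + z\<close> and
  \<open>y' = v + z\<close>, so both totals equal \<open>v + w + z\<close>.\<close>

lemma cycle_run_unique: "\<lbrakk>alternating l; cycle_run l x; cycle_run l y\<rbrakk> \<Longrightarrow> x = y"
proof (induction "length l" arbitrary: l x y rule: less_induct)
  case less
  show ?case
  proof (cases "\<exists>w l'. cycle_step l w l'")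
    case True
    then obtain v l1 x' where 1: "cycle_step l v l1" "cycle_run l1 x'" "x = v + x'"
      using less.prems(2) cycle_run_step_cases by metis
    from True obtain w l2 y' where 2: "cycle_step l w l2" "cycle_run l2 y'" "y = w + y'"
      using less.prems(3) cycle_run_step_cases by metis
    note IH1 = less.hyps[OF cycle_step_length[OF 1(1)] alternating_cycle_step[OF less.prems(1) 1(1)]]
    note IH2 = less.hyps[OF cycle_step_length[OF 2(1)] alternating_cycle_step[OF less.prems(1) 2(1)]]
    consider "v = w" "l1 = l2" | l3 where "cycle_step l1 w l3" "cycle_step l2 v l3"
      using cycle_step_joinable[OF less.prems(1) 1(1) 2(1)] unfolding joinable_def by blast
    then show ?thesis
    proof cases
      case 1
      then show ?thesis
        using IH1 \<open>cycle_run l1 x'\<close> 2 \<open>x = v + x'\<close> by simp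
    next
      case (2 l3)
      obtain z where "cycle_run l3 z"
        using cycle_run_exists by blast
      then have "x' = w + z" "y' = v + z"
        using IH1 IH2 cycle_run.step 2 \<open>cycle_run l1 x'\<close> \<open>cycle_run l2 y'\<close> by blast+
      then show ?thesis
        using \<open>x = v + x'\<close> \<open>y = w + y'\<close> by simp
    qed
  next
    case False
    then show ?thesis
      using less.prems(2,3) cycle_run_stop_eq by metis
  qed
qed


section \<open>Turning points\<close>

definition is_turning :: "nat \<Rightarrow> (nat \<Rightarrow> real) \<Rightarrow> nat \<Rightarrow> bool" where
  "is_turning T y k \<longleftrightarrow> 0 < k \<and> k < T \<and>
     (\<exists>m. k < m \<and> m \<le> T \<and> (\<forall>i. k \<le> i \<and> i < m \<longrightarrow> y i = y k) \<and>
          (y k - y (k - 1)) * (y m - y k) < 0)"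

lemma turning_points_eq: "turning_points T y = sorted_list_of_set ({0, T} \<union> Collect (is_turning T y))"
  unfolding turning_points_def is_turning_def ..

lemma is_turning_bounds: "is_turning T y k \<Longrightarrow> 0 < k" "is_turning T y k \<Longrightarrow> k < T"
  unfolding is_turning_def by blast+

text \<open>Only the first index of a plateau can be a turning point. This later rules out a second
  one on the same plateau.\<close>

lemma is_turning_left_neq: "is_turning T y k \<Longrightarrow> y (k - 1) \<noteq> y k"
  proof -
  assume "is_turning T y k"
  then obtain m where "(y k - y (k - 1)) * (y m - y k) < 0"
    unfolding is_turning_def by blast
  then show ?thesis
    by auto
qed

lemma finite_is_turning: "finite (Collect (is_turning T y))"
  by (rule finite_subset[of _ "{..<T}"]) (auto dest: is_turning_bounds)

lemma set_turning_points: "set (turning_points T y) = {0, T} \<union> Collect (is_turning T y)"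
  unfolding turning_points_eq by (rule set_sorted_list_of_set) (simp add: finite_is_turning)

lemma turning_points_le: "k \<in> set (turning_points T y) \<Longrightarrow> k \<le> T"
  by (auto simp: set_turning_points dest: is_turning_bounds)

lemma turning_points_strict_sorted: "sorted_wrt (<) (turning_points T y)"
  unfolding turning_points_eq by (rule strict_sorted_list_of_set)

lemma length_turning_points: "length (turning_points T y) \<le> T + 1"
proof -
  have "distinct (turning_points T y)"
    unfolding turning_points_eq by (rule distinct_sorted_list_of_set)
  then have "length (turning_points T y) = card (set (turning_points T y))"
    by (simp add: distinct_card)
  also have "\<dots> \<le> card {..T}"
    using turning_points_le by (intro card_mono) auto
  finally show ?thesis
    by simp
qed

text \<open>A negative \<open>a\<close> swaps peaks and valleys, but the defining product of two
  increments only picks up the positive factor \<open>a\<^sup>2\<close>.\<close>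

lemma turning_points_scale:
  assumes "a \<noteq> 0"
  shows "turning_points T (\<lambda>k. a * y k) = turning_points T y"
proof -
  have eq: "(a * y k - a * y (k - 1)) * (a * y m - a * y k) = a\<^sup>2 * ((y k - y (k - 1)) * (y m - y k))"
    for k m
    by (simp add: algebra_simps power2_eq_square)
  have "a\<^sup>2 * z < 0 \<longleftrightarrow> z < 0" for z
    using assms by (simp add: mult_less_0_iff)
  then show ?thesis
    unfolding turning_points_def eq using assms by simp
qed

section \<open>Monotonicity between turning points\<close>

lemma is_turning_peak:
  assumes "p < n" "n < T" "mono_on {p..n} y" "y p < y n" "y (Suc n) < y n"
  shows "\<exists>k. p < k \<and> k \<le> n \<and> is_turning T y k"
proof -
  \<comment> \<open>The peak may be a plateau ending at \<open>n\<close>; its turning point is its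
    first index, and \<open>Suc n\<close> is the witness \<open>m\<close> after the plateau.\<close>
  define k where "k = (LEAST i. y i = y n \<and> p \<le> i)"
  have k: "y k = y n" "p \<le> k"
    using LeastI[of "\<lambda>i. y i = y n \<and> p \<le> i" n] assms unfolding k_def by auto
  have "k \<le> n"
    unfolding k_def using assms by (intro Least_le) auto
  have "p < k"
    using k assms by (cases "p = k") auto
  have "y (k - 1) \<noteq> y n"
    using not_less_Least[of "k - 1" "\<lambda>i. y i = y n \<and> p \<le> i"] \<open>p < k\<close> unfolding k_def[symmetric] by auto
  moreover have "y (k - 1) \<le> y n"
    using assms(3) \<open>p < k\<close> \<open>k \<le> n\<close> by (intro mono_onD[OF assms(3)]) auto
  ultimately have neg: "(y k - y (k - 1)) * (y (Suc n) - y k) < 0"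
    using k assms by (auto simp: mult_less_0_iff)
  have const: "y i = y k" if "k \<le> i" "i < Suc n" for i
    using mono_onD[OF assms(3), of k i] mono_onD[OF assms(3), of i n] that k assms by auto
  have "0 < k" "k < T" "k < Suc n" "Suc n \<le> T"
    using \<open>p < k\<close> \<open>k \<le> n\<close> \<open>n < T\<close> by auto
  with neg const have "is_turning T y k"
    unfolding is_turning_def by blast
  then show ?thesis
    using \<open>p < k\<close> \<open>k \<le> n\<close> by blast
qed

lemma is_turning_uminus: "is_turning T (\<lambda>k. - y k) k \<longleftrightarrow> is_turning T y k"
proof -
  have "(- y k - - y (k - 1)) * (- y m - - y k) = (y k - y (k - 1)) * (y m - y k)" for m
    by (simp add: algebra_simps)
  then show ?thesis
    unfolding is_turning_def by simp
qed

text \<open>A drop after a genuine rise would create a turning point. So if \<open>y\<close> drops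
  after \<open>n\<close>, it was constant on \<open>{p..n}\<close>, and a constant stretch also
  counts as descending.\<close>

lemma mono_on_extend:
  assumes "p \<le> n" "n < T" "mono_on {p..n} y" and no: "\<And>k. p < k \<Longrightarrow> k \<le> n \<Longrightarrow> \<not> is_turning T y k"
  shows "mono_on {p..Suc n} y \<or> mono_on {p..Suc n} (\<lambda>k. - y k)"
proof (cases "y n \<le> y (Suc n)")
  case True
  then have "mono_on {p..Suc n} y"
    using assms(3) unfolding mono_on_def
    by (auto simp: le_Suc_eq intro: order_trans[OF _ True])
  then show ?thesis ..
next
  case False
  have "\<not> y p < y n"
    using is_turning_peak[of p n T y] assms False by (cases "p = n") auto
  then have const: "y i = y p" if "p \<le> i" "i \<le> n" for i
    using mono_onD[OF assms(3), of p i] mono_onD[OF assms(3), of i n] that by auto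
  have "mono_on {p..Suc n} (\<lambda>k. - y k)"
  proof (rule mono_onI)
    fix i j
    assume "i \<in> {p..Suc n}" "j \<in> {p..Suc n}" "i \<le> j"
    then show "- y i \<le> - y j"
      using False const[of i] const[of j] const[of n] assms(1) by (cases "j = Suc n"; cases "i = Suc n") auto
  qed
  then show ?thesis ..
qed

lemma mono_on_between_turning:
  assumes "p \<le> n" "n \<le> T" and "\<And>k. p < k \<Longrightarrow> k < n \<Longrightarrow> \<not> is_turning T y k"
  shows "mono_on {p..n} y \<or> mono_on {p..n} (\<lambda>k. - y k)"
  using assms
proof (induction n rule: dec_induct)
  case base
  then show ?case
    by (simp add: mono_on_def)
next
  case (step n)
  then consider "mono_on {p..n} y" | "mono_on {p..n} (\<lambda>k. - y k)"
    by auto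
  then show ?case
  proof cases
    case 1
    then show ?thesis
      using step mono_on_extend[of p n T y] by auto
  next
    case 2
    then show ?thesis
      using step mono_on_extend[of p n T "\<lambda>k. - y k"] by (auto simp: is_turning_uminus)
  qed
qed

text \<open>Around an inner turning point \<open>q\<close> the profile is monotone on each side up
  to the neighbours \<open>p\<close> and \<open>r\<close>. Hence the strict sign change between
  \<open>q - 1\<close>, \<open>q\<close> and the first index \<open>m\<close> after the plateau
  carries over to the values at \<open>p\<close>, \<open>q\<close>, \<open>r\<close>.\<close>

lemma turning_points_alternating: "alternating (map y (turning_points T y))"
proof (rule alternatingI)
  fix vs u v w ws
  assume "map y (turning_points T y) = vs @ [u, v, w] @ ws"
  then obtain xs p q r zs where ps: "turning_points T y = xs @ [p, q, r] @ zs"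
    and uvw: "u = y p" "v = y q" "w = y r"
    by (auto simp: map_eq_append_conv map_eq_Cons_conv Cons_eq_map_conv append_eq_map_conv)
  let ?A = "{0, T} \<union> Collect (is_turning T y)"
  have A: "?A = set xs \<union> {p, q, r} \<union> set zs"
    using set_turning_points[of T y] ps by auto
  have srt: "\<And>x. x \<in> set xs \<Longrightarrow> x < p" "p < q" "q < r" "\<And>x. x \<in> set zs \<Longrightarrow> r < x"
    using turning_points_strict_sorted[of T y] unfolding ps by (auto simp: sorted_wrt_append)
  have "r \<le> T"
    using turning_points_le[of r T y] ps by simp
  have gaps: "k \<notin> ?A" if "p < k" "k < r" "k \<noteq> q" for k
    unfolding A using srt(1,4)[of k] that by auto
  have "q \<in> ?A"
    unfolding A by simp
  then have "is_turning T y q"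
    using srt \<open>r \<le> T\<close> by auto
  then obtain m where m: "q < m" "m \<le> T" "\<forall>i. q \<le> i \<and> i < m \<longrightarrow> y i = y q"
    "(y q - y (q - 1)) * (y m - y q) < 0"
    unfolding is_turning_def by blast
  \<comment> \<open>Otherwise \<open>r\<close> would lie on the plateau of \<open>q\<close> and
    differ from \<open>T\<close>, yet an interior listed point differs in value from its left
    neighbour.\<close>
  have "m \<le> r"
  proof (rule ccontr)
    assume "\<not> m \<le> r"
    then have "q \<le> r" "r < m" "q \<le> r - 1" "r - 1 < m"
      using srt(3) by linarith+
    then have "y r = y q" "y (r - 1) = y q"
      using m(3)[rule_format, of r] m(3)[rule_format, of "r - 1"] by blast+
    moreover have "r \<noteq> T" "r \<noteq> 0"
      using \<open>\<not> m \<le> r\<close> m(2) srt(3) by auto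
    moreover have "r \<in> ?A"
      unfolding A by simp
    ultimately show False
      using is_turning_left_neq[of T y r] by auto
  qed
  have left: "mono_on {p..q} y \<or> mono_on {p..q} (\<lambda>k. - y k)"
    using gaps srt(2,3) \<open>r \<le> T\<close> by (intro mono_on_between_turning[where T = T]) auto
  have right: "mono_on {q..r} y \<or> mono_on {q..r} (\<lambda>k. - y k)"
    using gaps srt(2,3) \<open>r \<le> T\<close> by (intro mono_on_between_turning[where T = T]) auto
  have l: "y p \<le> y (q - 1) \<and> y (q - 1) \<le> y q \<or> y p \<ge> y (q - 1) \<and> y (q - 1) \<ge> y q"
    using left
  proof
    assume "mono_on {p..q} y"
    then show ?thesis
      using srt by (auto dest: mono_onD[where r = p and s = "q - 1"] mono_onD[where r = "q - 1" and s = q])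
  next
    assume "mono_on {p..q} (\<lambda>k. - y k)"
    from mono_onD[OF this, of p "q - 1"] mono_onD[OF this, of "q - 1" q] show ?thesis
      using srt by auto
  qed
  have r: "y q \<le> y m \<and> y m \<le> y r \<or> y q \<ge> y m \<and> y m \<ge> y r"
    using right
  proof
    assume "mono_on {q..r} y"
    from mono_onD[OF this, of q m] mono_onD[OF this, of m r] show ?thesis
      using m(1) \<open>m \<le> r\<close> by auto
  next
    assume "mono_on {q..r} (\<lambda>k. - y k)"
    from mono_onD[OF this, of q m] mono_onD[OF this, of m r] show ?thesis
      using m(1) \<open>m \<le> r\<close> by auto
  qed
  show "(v - u) * (w - v) < 0"
    using l r m(4) unfolding uvw by (auto simp: mult_less_0_iff)
qed


section \<open>Homogeneity of the rainflow map\<close>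

definition depth_energy :: "(nat \<Rightarrow> real) \<Rightarrow> (nat \<times> nat) list \<Rightarrow> real" where
  "depth_energy y hs = (\<Sum>(p, q)\<leftarrow>hs. (y q - y p)\<^sup>2)"

text \<open>Forgetting the times loses no extraction: a closed quadruple of values always comes from
  a closed quadruple of time points, so a residue is also final for
  \<open>cycle_run\<close>.\<close>

lemma cycle_run_rainflow: "rainflow y ps hs \<Longrightarrow> cycle_run (map y ps) (depth_energy y hs)"
proof (induction rule: rainflow.induct)
  case (full_cycle p q r s xs zs hs)
  have "cycle_step (map y (xs @ [p, q, r, s] @ zs)) (2 * (y r - y q)\<^sup>2) (map y (xs @ [p, s] @ zs))"
    using full_cycle(1) unfolding closed_cycle_def
    by (intro cycle_stepI[where xs = "map y xs" and zs = "map y zs"]) auto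
  from cycle_run.step[OF this full_cycle.IH] show ?case
    by (simp add: depth_energy_def)
next
  case (residue ps)
  have "\<nexists>w l'. cycle_step (map y ps) w l'"
    using residue unfolding cycle_step_def closed_cycle_def
    by (fastforce simp: map_eq_append_conv map_eq_Cons_conv Cons_eq_map_conv append_eq_map_conv)
  from cycle_run.stop[OF this] show ?case
    by (simp add: depth_energy_def zip_map_map map_tl[symmetric] comp_def case_prod_unfold)
qed

lemma depth_energy_unique:
  assumes "rainflow y (turning_points T y) hs" "rainflow y (turning_points T y) hs'"
  shows "depth_energy y hs = depth_energy y hs'"
  by (rule cycle_run_unique[OF turning_points_alternating assms[THEN cycle_run_rainflow]])

text \<open>Closedness only compares ranges, and all of them are multiplied by the same positive
  factor \<open>\<bar>a\<bar>\<close>.\<close>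

lemma rainflow_scale:
  assumes "rainflow y ps hs" "a \<noteq> 0"
  shows "rainflow (\<lambda>k. a * y k) ps hs"
proof -
  have "\<bar>a * y q - a * y p\<bar> = \<bar>a\<bar> * \<bar>y q - y p\<bar>" for p q
    by (simp add: abs_mult[symmetric] right_diff_distrib)
  then have "closed_cycle (\<lambda>k. a * y k) = closed_cycle y"
    using assms(2) by (intro ext) (simp add: closed_cycle_def)
  note closed = this[THEN fun_cong, THEN fun_cong, THEN fun_cong, THEN fun_cong]
  show ?thesis
    using assms(1)
  proof (induction rule: rainflow.induct)
    case (full_cycle p q r s xs zs hs)
    then show ?case
      using rainflow.full_cycle[of "\<lambda>k. a * y k" p q r s xs zs hs] closed by blast
  next
    case (residue ps)
    then show ?case
      using rainflow.residue[of ps "\<lambda>k. a * y k"] closed by blast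
  qed
qed

text \<open>Needed because a matrix row sums over the times after \<open>p\<close> up to
  \<open>q\<close>, which telescopes to a profile difference only if \<open>p\<close> does not
  exceed \<open>q\<close>.\<close>

lemma rainflow_intervals:
  "\<lbrakk>rainflow y ps hs; sorted_wrt (<) ps; (p, q) \<in> set hs\<rbrakk> \<Longrightarrow> p < q"
proof (induction rule: rainflow.induct)
  case (full_cycle p' q' r' s' xs zs hs)
  then show ?case
    by (auto simp: sorted_wrt_append)
next
  case (residue ps)
  then obtain i where "i < length ps - 1" "p = ps ! i" "q = ps ! Suc i"
    by (auto simp: set_zip nth_tl)
  then show ?case
    using residue.prems(1) by (simp add: sorted_wrt_nth_less)
qed

section \<open>From recorded half-cycles to the norm of \<open>N u *v u\<close>\<close>

lemma bij_betw_time_index: "bij_betw time_index (UNIV :: 't::{finite,linorder} set) {1..CARD('t)}"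
proof -
  have "strict_mono (time_index :: 't \<Rightarrow> nat)"
    unfolding strict_mono_def time_index_def by (auto intro!: psubset_card_mono)
  then have inj: "inj (time_index :: 't \<Rightarrow> nat)"
    by (rule strict_mono_imp_inj_on)
  have "time_index t \<ge> 1" for t :: 't
    using card_mono[of "{..t}" "{t}"] by (simp add: time_index_def)
  moreover have "time_index t \<le> CARD('t)" for t :: 't
    unfolding time_index_def by (intro card_mono) auto
  ultimately have "range (time_index :: 't \<Rightarrow> nat) \<subseteq> {1..CARD('t)}"
    by auto
  moreover have "card (range (time_index :: 't \<Rightarrow> nat)) = card {1..CARD('t)}"
    using inj by (simp add: card_image)
  ultimately have "range (time_index :: 't \<Rightarrow> nat) = {1..CARD('t)}"
    by (intro card_subset_eq) auto
  with inj show ?thesis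
    by (simp add: bij_betw_def)
qed

lemma profile_diff:
  fixes u :: "real ^ 't::{finite,linorder}"
  assumes "p \<le> q"
  shows "(\<Sum>t | p < time_index t \<and> time_index t \<le> q. u $ t) = profile u q - profile u p"
proof -
  have "{t::'t. time_index t \<le> q} =
      {t. time_index t \<le> p} \<union> {t. p < time_index t \<and> time_index t \<le> q}"
    using assms by auto
  moreover have "{t::'t. time_index t \<le> p} \<inter> {t. p < time_index t \<and> time_index t \<le> q} = {}"
    by auto
  ultimately show ?thesis
    unfolding profile_def by (simp add: sum.union_disjoint)
qed

lemma profile_scaleR: "profile (a *\<^sub>R u) = (\<lambda>k. a * profile u k)"
  by (simp add: profile_def fun_eq_iff sum_distrib_left)

text \<open>The row sum telescopes to \<open>profile u q - profile u p\<close>, and the sign stored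
  in the row turns it into the depth.\<close>

lemma half_cycle_matrix_mult:
  fixes u :: "real ^ 't::{finite,linorder}"
  assumes "\<And>p q. (p, q) \<in> set hs \<Longrightarrow> p < q"
  shows "((half_cycle_matrix (profile u) hs :: real ^ 't::{finite,linorder} ^ 't::{finite,linorder}) *v u) $ i =
    (if time_index i \<le> length hs
     then (case hs ! (time_index i - 1) of (p, q) \<Rightarrow> \<bar>profile u q - profile u p\<bar>) else 0)"
proof (cases "time_index i \<le> length hs")
  case True
  obtain p q where pq: "hs ! (time_index i - 1) = (p, q)"
    by fastforce
  have "time_index i \<ge> 1"
    using bij_betw_time_index[where 't = 't] by (auto simp: bij_betw_def)
  then have "p < q"
    using True pq assms nth_mem[of "time_index i - 1" hs] by auto
  have "((half_cycle_matrix (profile u) hs :: real ^ 't::{finite,linorder} ^ 't::{finite,linorder}) *v u) $ i =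
      (\<Sum>t\<in>UNIV. if p < time_index t \<and> time_index t \<le> q then sgn (profile u q - profile u p) * u $ t else 0)"
    using True pq by (auto simp: matrix_vector_mult_def half_cycle_matrix_def intro!: sum.cong)
  also have "\<dots> = sgn (profile u q - profile u p) * (\<Sum>t | p < time_index t \<and> time_index t \<le> q. u $ t)"
    by (simp add: sum.If_cases sum_distrib_left)
  also have "\<dots> = \<bar>profile u q - profile u p\<bar>"
    using \<open>p < q\<close> by (simp add: profile_diff sgn_if)
  finally show ?thesis
    using True pq by simp
qed (simp add: matrix_vector_mult_def half_cycle_matrix_def)

lemma norm_half_cycle_matrix_mult:
  fixes u :: "real ^ 't::{finite,linorder}"
  assumes "\<And>p q. (p, q) \<in> set hs \<Longrightarrow> p < q" "length hs \<le> CARD('t)"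
  shows "(norm ((half_cycle_matrix (profile u) hs :: real ^ 't::{finite,linorder} ^ 't::{finite,linorder}) *v u))\<^sup>2 = depth_energy (profile u) hs"
proof -
  define f where "f = (\<lambda>(p, q). (profile u q - profile u p)\<^sup>2)"
  let ?g = "\<lambda>k. if k \<le> length hs then f (hs ! (k - 1)) else 0"
  have "(norm ((half_cycle_matrix (profile u) hs :: real ^ 't::{finite,linorder} ^ 't::{finite,linorder}) *v u))\<^sup>2 =
      (\<Sum>i\<in>UNIV. (((half_cycle_matrix (profile u) hs :: real ^ 't::{finite,linorder} ^ 't::{finite,linorder}) *v u) $ i)\<^sup>2)"
    by (simp add: norm_vec_def L2_set_def sum_nonneg)
  also have "\<dots> = (\<Sum>i\<in>(UNIV :: 't set). ?g (time_index i))"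
    using assms(1) by (intro sum.cong) (auto simp: half_cycle_matrix_mult f_def split: prod.split)
  also have "\<dots> = (\<Sum>k\<in>{1..CARD('t)}. ?g k)"
    by (rule sum.reindex_bij_betw[OF bij_betw_time_index])
  \<comment> \<open>Rows beyond \<open>length hs\<close> are zero padding, and the length bound
    ensures that no half-cycle lacks a row.\<close>
  also have "\<dots> = (\<Sum>k\<in>{1..length hs}. f (hs ! (k - 1)))"
    using assms(2) by (intro sum.mono_neutral_cong_right) auto
  also have "\<dots> = (\<Sum>k<length hs. f (hs ! k))"
    by (intro sum.reindex_bij_witness[of _ Suc "\<lambda>k. k - 1"]) auto
  also have "\<dots> = (\<Sum>h\<leftarrow>hs. f h)"
    by (simp add: sum_list_sum_nth atLeast0LessThan)
  finally show ?thesis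
    by (simp add: depth_energy_def f_def)
qed

text \<open>By uniqueness of the energy, \<open>hs\<close> may be any run, not just the one that
  \<open>N\<close> encodes at \<open>u\<close>.\<close>

lemma rainflow_map_norm:
  fixes N :: "real ^ 't::{finite,linorder} \<Rightarrow> real ^ 't::{finite,linorder} ^ 't::{finite,linorder}"
  assumes "rainflow_map N" "rainflow (profile u) (turning_points CARD('t) (profile u)) hs"
  shows "(norm (N u *v u))\<^sup>2 = depth_energy (profile u) hs"
proof -
  obtain hs' where hs': "rainflow (profile u) (turning_points CARD('t) (profile u)) hs'"
    "N u = half_cycle_matrix (profile u) hs'"
    using assms(1) unfolding rainflow_map_def by blast
  have "length hs' \<le> CARD('t)"
    using rainflow_length[OF hs'(1)] length_turning_points[of "CARD('t)" "profile u"] by simp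
  then have "(norm (N u *v u))\<^sup>2 = depth_energy (profile u) hs'"
    unfolding hs'(2) using rainflow_intervals[OF hs'(1) turning_points_strict_sorted]
    by (intro norm_half_cycle_matrix_mult)
  also have "\<dots> = depth_energy (profile u) hs"
    by (rule depth_energy_unique[OF hs'(1) assms(2)])
  finally show ?thesis .
qed

text \<open>For nonzero \<open>a\<close>, one run \<open>hs\<close> is valid for both
  \<open>u\<close> and \<open>a *\<^sub>R u\<close>, and it computes both norms however
  \<open>N\<close> resolves ties at the two profiles.\<close>

lemma rainflow_map_norm_scale:
  fixes N :: "real ^ 't::{finite,linorder} \<Rightarrow> real ^ 't::{finite,linorder} ^ 't::{finite,linorder}"
  assumes "rainflow_map N"
  shows "(norm (N (a *\<^sub>R u) *v (a *\<^sub>R u)))\<^sup>2 = a\<^sup>2 * (norm (N u *v u))\<^sup>2"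
proof (cases "a = 0")
  case False
  obtain hs where hs: "rainflow (profile u) (turning_points CARD('t) (profile u)) hs"
    using rainflow_exists by blast
  have "rainflow (profile (a *\<^sub>R u)) (turning_points CARD('t) (profile (a *\<^sub>R u))) hs"
    unfolding profile_scaleR turning_points_scale[OF False] by (rule rainflow_scale[OF hs False])
  then have "(norm (N (a *\<^sub>R u) *v (a *\<^sub>R u)))\<^sup>2 = depth_energy (profile (a *\<^sub>R u)) hs"
    by (rule rainflow_map_norm[OF assms])
  also have "\<dots> = a\<^sup>2 * depth_energy (profile u) hs"
    by (simp add: depth_energy_def profile_scaleR case_prod_unfold sum_list_const_mult[symmetric]
        right_diff_distrib[symmetric] power_mult_distrib)
  finally show ?thesis
    using rainflow_map_norm[OF assms hs] by simp
qed (simp add: matrix_vector_mult_0_right)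


section \<open>Optimal bids and market clearing\<close>

lemma is_arg_max_concave_quadratic:
  fixes q :: real
  assumes "q > 0" and f: "\<And>a. f a = k + l * a - q / 2 * a\<^sup>2"
  shows "is_arg_max f (\<lambda>_. True) x \<longleftrightarrow> x = l / q"
proof -
  \<comment> \<open>Completing the square.\<close>
  have diff: "f (l / q) - f a = q / 2 * (a - l / q)\<^sup>2" for a
    using \<open>q > 0\<close> unfolding f by (simp add: field_simps power2_eq_square)
  show ?thesis
  proof
    assume "is_arg_max f (\<lambda>_. True) x"
    then have "f (l / q) - f x \<le> 0"
      by (auto simp: is_arg_max_def not_less)
    then have "(x - l / q)\<^sup>2 \<le> 0"
      using \<open>q > 0\<close> by (simp add: diff mult_le_0_iff)
    then show "x = l / q"
      by simp
  next
    assume "x = l / q"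
    moreover have "f a \<le> f (l / q)" for a
      using diff[of a] \<open>q > 0\<close> by (smt (verit) divide_nonneg_nonneg mult_nonneg_nonneg zero_le_power2)
    ultimately show "is_arg_max f (\<lambda>_. True) x"
      by (auto simp: is_arg_max_def not_less)
  qed
qed

text \<open>The decision-aware bid cancels \<open>gd\<close>, leaving the total dispatch
  \<open>a *\<^sub>R lr\<close>. The linear and quadratic coefficients both carry
  \<open>(norm lr)\<^sup>2\<close>, so the price drops out of the optimum.\<close>

lemma generator_bid_optimal_iff:
  assumes "c > 0" "lr \<noteq> 0"
  shows "is_arg_max (generator_profit ld lr c gd) (\<lambda>_. True) a \<longleftrightarrow> a = inverse c"
proof -
  have "generator_profit ld lr c gd a =
      (ld \<bullet> gd - lr \<bullet> gd) + (norm lr)\<^sup>2 * a - (c * (norm lr)\<^sup>2) / 2 * a\<^sup>2" for a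
    by (simp add: generator_profit_def generator_cost_def real_time_dispatch_def inner_diff_right
        power2_norm_eq_inner[of lr] power_mult_distrib algebra_simps)
  moreover have "c * (norm lr)\<^sup>2 > 0"
    using assms by simp
  ultimately have "is_arg_max (generator_profit ld lr c gd) (\<lambda>_. True) a \<longleftrightarrow>
      a = (norm lr)\<^sup>2 / (c * (norm lr)\<^sup>2)"
    by (intro is_arg_max_concave_quadratic)
  then show ?thesis
    using assms by (simp add: field_simps)
qed

text \<open>Homogeneity makes the cost of the total dispatch \<open>a *\<^sub>R lr\<close> exactly
  quadratic in \<open>a\<close>, and the nonzero depth vector makes the profit strictly
  concave.\<close>

lemma storage_bid_optimal_iff:
  assumes "rainflow_map N" "b > 0" "norm (N lr *v lr) \<noteq> 0"
  shows "is_arg_max (storage_profit N thd lr b ud) (\<lambda>_. True) x \<longleftrightarrow>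
    x = inverse b * ((norm lr)\<^sup>2 / (norm (N lr *v lr))\<^sup>2)"
proof -
  have "storage_profit N thd lr b ud a =
      (thd \<bullet> (N ud *v ud) - lr \<bullet> ud) + (norm lr)\<^sup>2 * a - (b * (norm (N lr *v lr))\<^sup>2) / 2 * a\<^sup>2" for a
  proof -
    have "storage_cost N b (ud + real_time_dispatch a lr ud) = b / 2 * (a\<^sup>2 * (norm (N lr *v lr))\<^sup>2)"
      using rainflow_map_norm_scale[OF assms(1), of a lr]
      by (simp add: storage_cost_def real_time_dispatch_def)
    then show ?thesis
      by (simp add: storage_profit_def real_time_dispatch_def inner_diff_right
          power2_norm_eq_inner[of lr] algebra_simps)
  qed
  moreover have "b * (norm (N lr *v lr))\<^sup>2 > 0"
    using assms by simp
  ultimately have "is_arg_max (storage_profit N thd lr b ud) (\<lambda>_. True) x \<longleftrightarrow>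
      x = (norm lr)\<^sup>2 / (b * (norm (N lr *v lr))\<^sup>2)"
    by (intro is_arg_max_concave_quadratic)
  then show ?thesis
    by (simp add: field_simps)
qed

lemma clearing_iff:
  "dr = (\<Sum>j\<in>G. real_time_dispatch (\<alpha> j) lr (gd j)) + (\<Sum>s\<in>S. real_time_dispatch (\<beta> s) lr (ud s))
   \<longleftrightarrow> (\<Sum>j\<in>G. gd j) + (\<Sum>s\<in>S. ud s) + dr = (sum \<beta> S + sum \<alpha> G) *\<^sub>R lr"
proof -
  have eq: "(\<Sum>j\<in>G. real_time_dispatch (\<alpha> j) lr (gd j)) + (\<Sum>s\<in>S. real_time_dispatch (\<beta> s) lr (ud s)) =
      (sum \<beta> S + sum \<alpha> G) *\<^sub>R lr - ((\<Sum>j\<in>G. gd j) + (\<Sum>s\<in>S. ud s))"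
    by (simp add: real_time_dispatch_def sum_subtractf scaleR_left_distrib scaleR_sum_left)
  show ?thesis
    unfolding eq eq_diff_eq by (simp only: add.commute[of dr])
qed

text \<open>Bids matter only on \<open>G\<close> and \<open>S\<close>; \<open>extensional\<close>
  fixes their values elsewhere, so that uniqueness of the tuple is meaningful. The second conjunct
  characterizes equilibria for arbitrary bid functions.\<close>

theorem theorem5:
  fixes N :: "real ^ 't::{finite,linorder} \<Rightarrow> real ^ 't::{finite,linorder} ^ 't::{finite,linorder}"
    and G :: "'g set" and S :: "'s set"
    and c :: "'g \<Rightarrow> real" and b :: "'s \<Rightarrow> real"
    and ld :: "real ^ 't::{finite,linorder}" and thd :: "'s \<Rightarrow> real ^ 't::{finite,linorder}"
    and gd :: "'g \<Rightarrow> real ^ 't::{finite,linorder}" and ud :: "'s \<Rightarrow> real ^ 't::{finite,linorder}"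
    and dd dr d :: "real ^ 't::{finite,linorder}" and \<phi> :: real
  assumes "rainflow_map N"
    and "finite G" and "finite S"
    and "\<And>j. j \<in> G \<Longrightarrow> c j > 0" and "\<And>s. s \<in> S \<Longrightarrow> b s > 0"
    and "(\<Sum>j\<in>G. gd j) + (\<Sum>s\<in>S. ud s) = dd"
    and "d = dd + dr"
    and "norm (N d *v d) \<noteq> 0" and "\<phi> \<noteq> 0"
    and "inverse \<phi> = (\<Sum>s\<in>S. inverse (b s) * ((norm d)\<^sup>2 / (norm (N d *v d))\<^sup>2))
                     + (\<Sum>j\<in>G. inverse (c j))"
  shows "(\<exists>!e. case e of (lr, \<alpha>, \<beta>) \<Rightarrow> \<alpha> \<in> extensional G \<and> \<beta> \<in> extensional S \<and>
            competitive_equilibrium N G S c b ld thd gd ud dr lr \<alpha> \<beta>) \<and>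
         (\<forall>lr \<alpha> \<beta>. competitive_equilibrium N G S c b ld thd gd ud dr lr \<alpha> \<beta> \<longleftrightarrow>
            lr = \<phi> *\<^sub>R d \<and>
            (\<forall>j\<in>G. \<alpha> j = inverse (c j)) \<and>
            (\<forall>s\<in>S. \<beta> s = inverse (b s) * ((norm lr)\<^sup>2 / (norm (N lr *v lr))\<^sup>2)))"
proof -
  let ?eq = "competitive_equilibrium N G S c b ld thd gd ud dr"
  \<comment> \<open>The claimed storage bid with \<open>d\<close> in place of the price;
    \<open>ratio\<close> shows that it is the same for every nonzero multiple of
    \<open>d\<close>.\<close>
  define \<beta>0 where "\<beta>0 s = inverse (b s) * ((norm d)\<^sup>2 / (norm (N d *v d))\<^sup>2)" for s
  have "d \<noteq> 0"
    using assms(8) by auto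
  have total: "sum \<beta>0 S + (\<Sum>j\<in>G. inverse (c j)) = inverse \<phi>"
    using assms(10) by (simp add: \<beta>0_def)
  have ratio: "norm (N (k *\<^sub>R d) *v (k *\<^sub>R d)) \<noteq> 0"
    "inverse (b s) * ((norm (k *\<^sub>R d))\<^sup>2 / (norm (N (k *\<^sub>R d) *v (k *\<^sub>R d)))\<^sup>2) = \<beta>0 s"
    if "k \<noteq> 0" for k s
    using rainflow_map_norm_scale[OF assms(1), of k d] that assms(8)
    by (auto simp: \<beta>0_def power_mult_distrib simp del: norm_eq_zero)
  have clear: "dr = (\<Sum>j\<in>G. real_time_dispatch (\<alpha> j) lr (gd j)) + (\<Sum>s\<in>S. real_time_dispatch (\<beta> s) lr (ud s))
      \<longleftrightarrow> d = (sum \<beta> S + sum \<alpha> G) *\<^sub>R lr" for \<alpha> \<beta> lr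
    unfolding clearing_iff assms(6) assms(7) ..
  \<comment> \<open>Along the line through \<open>d\<close> the optimal bids do not depend on
    \<open>k\<close>. They sum to \<open>inverse \<phi>\<close>, so clearing is left to fix
    \<open>k\<close>.\<close>
  have direction: "?eq (k *\<^sub>R d) \<alpha> \<beta> \<longleftrightarrow>
      (\<forall>j\<in>G. \<alpha> j = inverse (c j)) \<and> (\<forall>s\<in>S. \<beta> s = \<beta>0 s) \<and> k = \<phi>" if "k \<noteq> 0" for k \<alpha> \<beta>
  proof -
    have "?eq (k *\<^sub>R d) \<alpha> \<beta> \<longleftrightarrow> (\<forall>j\<in>G. \<alpha> j = inverse (c j)) \<and> (\<forall>s\<in>S. \<beta> s = \<beta>0 s) \<and>
        d = (sum \<beta> S + sum \<alpha> G) *\<^sub>R k *\<^sub>R d"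
    proof -
      have "is_arg_max (generator_profit ld (k *\<^sub>R d) (c j) (gd j)) (\<lambda>_. True) (\<alpha> j) \<longleftrightarrow> \<alpha> j = inverse (c j)"
        if "j \<in> G" for j
        using \<open>k \<noteq> 0\<close> \<open>d \<noteq> 0\<close> assms(4)[OF that] by (intro generator_bid_optimal_iff) simp_all
      moreover have "is_arg_max (storage_profit N (thd s) (k *\<^sub>R d) (b s) (ud s)) (\<lambda>_. True) (\<beta> s) \<longleftrightarrow> \<beta> s = \<beta>0 s"
        if "s \<in> S" for s
        unfolding storage_bid_optimal_iff[OF assms(1) assms(5)[OF that] ratio(1)[OF \<open>k \<noteq> 0\<close>]]
          ratio(2)[OF \<open>k \<noteq> 0\<close>] ..
      ultimately show ?thesis
        unfolding competitive_equilibrium_def clear by (auto simp del: scaleR_scaleR)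
    qed
    also have "\<dots> \<longleftrightarrow> (\<forall>j\<in>G. \<alpha> j = inverse (c j)) \<and> (\<forall>s\<in>S. \<beta> s = \<beta>0 s) \<and>
        d = (inverse \<phi> * k) *\<^sub>R d"
      using total by (auto cong: sum.cong)
    also have "d = (inverse \<phi> * k) *\<^sub>R d \<longleftrightarrow> k = \<phi>"
      using \<open>d \<noteq> 0\<close> assms(9) scaleR_cancel_right[of 1 d "inverse \<phi> * k"] by (auto simp: field_simps)
    finally show ?thesis .
  qed
  have char: "?eq lr \<alpha> \<beta> \<longleftrightarrow> lr = \<phi> *\<^sub>R d \<and> (\<forall>j\<in>G. \<alpha> j = inverse (c j)) \<and> (\<forall>s\<in>S. \<beta> s = \<beta>0 s)"
    for lr \<alpha> \<beta>
  proof
    assume eq: "?eq lr \<alpha> \<beta>"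
    define K where "K = sum \<beta> S + sum \<alpha> G"
    have "d = K *\<^sub>R lr"
      using eq unfolding competitive_equilibrium_def clear K_def by blast
    \<comment> \<open>Clearing alone puts the price on the line through \<open>d\<close>, before
      anything is known about the bids: \<open>K = 0\<close> would give
      \<open>d = 0\<close>.\<close>
    then have "inverse K \<noteq> 0" "lr = inverse K *\<^sub>R d"
      using \<open>d \<noteq> 0\<close> by auto
    then show "lr = \<phi> *\<^sub>R d \<and> (\<forall>j\<in>G. \<alpha> j = inverse (c j)) \<and> (\<forall>s\<in>S. \<beta> s = \<beta>0 s)"
      using eq direction by metis
  qed (use direction assms(9) in blast)
  have "\<exists>!e. case e of (lr, \<alpha>, \<beta>) \<Rightarrow> \<alpha> \<in> extensional G \<and> \<beta> \<in> extensional S \<and> ?eq lr \<alpha> \<beta>"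
    unfolding char
  proof (rule ex1I[of _ "(\<phi> *\<^sub>R d, restrict (\<lambda>j. inverse (c j)) G, restrict \<beta>0 S)"])
    fix e
    assume "case e of (lr, \<alpha>, \<beta>) \<Rightarrow> \<alpha> \<in> extensional G \<and> \<beta> \<in> extensional S \<and>
      lr = \<phi> *\<^sub>R d \<and> (\<forall>j\<in>G. \<alpha> j = inverse (c j)) \<and> (\<forall>s\<in>S. \<beta> s = \<beta>0 s)"
    then show "e = (\<phi> *\<^sub>R d, restrict (\<lambda>j. inverse (c j)) G, restrict \<beta>0 S)"
      by (auto intro: extensionalityI)
  qed auto
  moreover have "?eq lr \<alpha> \<beta> \<longleftrightarrow> lr = \<phi> *\<^sub>R d \<and> (\<forall>j\<in>G. \<alpha> j = inverse (c j)) \<and>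
      (\<forall>s\<in>S. \<beta> s = inverse (b s) * ((norm lr)\<^sup>2 / (norm (N lr *v lr))\<^sup>2))" for lr \<alpha> \<beta>
    unfolding char using ratio(2)[OF assms(9)] by auto
  ultimately show ?thesis
    by blast
qed

end
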